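(* Let $n \ge 2$, $w \in \mathfrak{S}_n$ and $k \in [1,n-1]$. Then $$\min\nolimits_k(w) = \Big| \big\{w(1),\ldots,w(k)\big\} \cap \big\{k+1,\ldots, n\big\} \Big| \;\Big(= \Big| \big\{w(k+1),\ldots,w(n)\big\} \cap \big\{1,\ldots, k\big\} \Big|\Big).$$
   Context: $\mathfrak{S}_n$ is the symmetric group on $[1,n]$, and $\sigma_i$ ($1\le i\le n-1$) is the simple reflection (adjacent transposition) exchanging $i$ and $i+1$. A reduced decomposition of $w$ is an expression of $w$ as a product of simple reflections with the minimum possible number of factors (the length $\ell(w)$). For $k\in[1,n-1]$, $\min_k(w)$ denotes the minimum, over all reduced decompositions of $w$, of the number of times $\sigma_k$ appears as a factor, and $\max_k(w)$ the corresponding maximum. *)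

theory Defs
  imports "HOL-Combinatorics.Permutations"
begin

definition simple_reflection :: "nat \<Rightarrow> nat \<Rightarrow> nat" where
  "simple_reflection i = transpose i (Suc i)"

text \<open>A word \<open>[i\<^sub>1, \<dots>, i\<^sub>r]\<close> stands for the product
  \<open>\<sigma>\<^bsub>i\<^sub>1\<^esub> \<circ> \<dots> \<circ> \<sigma>\<^bsub>i\<^sub>r\<^esub>\<close>: products are compositions of maps, the rightmost
  factor acting first.\<close>

definition word_product :: "nat list \<Rightarrow> nat \<Rightarrow> nat" where
  "word_product is = foldr (\<lambda>i f. simple_reflection i \<circ> f) is id"

definition decompositions :: "nat \<Rightarrow> (nat \<Rightarrow> nat) \<Rightarrow> nat list set" where
  "decompositions n w = {is. set is \<subseteq> {1..n - 1} \<and> word_product is = w}"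

definition perm_length :: "nat \<Rightarrow> (nat \<Rightarrow> nat) \<Rightarrow> nat" where
  "perm_length n w = (LEAST r. \<exists>is \<in> decompositions n w. length is = r)"

definition reduced_decompositions :: "nat \<Rightarrow> (nat \<Rightarrow> nat) \<Rightarrow> nat list set" where
  "reduced_decompositions n w = {is \<in> decompositions n w. length is = perm_length n w}"

text \<open>For \<open>w\<close> in the symmetric group on \<open>{1..n}\<close> the set of reduced decompositions is
  finite and nonempty, so the following \<open>Min\<close> is a genuine minimum.\<close>

definition min_occ :: "nat \<Rightarrow> nat \<Rightarrow> (nat \<Rightarrow> nat) \<Rightarrow> nat" where
  "min_occ n k w = Min ((\<lambda>is. count_list is k) ` reduced_decompositions n w)"

end

theory Submission
  imports Defs
begin

text \<open>Appending \<open>\<sigma>\<^sub>i\<close> to a word composes on the right, which changes the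
  inversion number by one and changes \<open>card (w ` {1..k} \<inter> {k + 1..n})\<close> only if
  \<open>i = k\<close>, and then by at most one; this gives the lower bounds. Conversely, every descent
  \<open>i \<noteq> k\<close> of \<open>w\<close> can be stripped off without affecting the cardinality. If \<open>k\<close> is the
  only descent, then \<open>w\<close> is increasing on \<open>{1..k}\<close> and on \<open>{k + 1..n}\<close>, which forces
  \<open>w (k + 1) \<le> k < w k\<close>, so stripping off \<open>\<sigma>\<^sub>k\<close> lowers the cardinality by exactly one.\<close>

text \<open>Pairs of positions rather than of values, so that composing with
  \<open>\<sigma>\<^sub>i\<close> on the right relabels the pairs.\<close>

definition inversions :: "nat \<Rightarrow> (nat \<Rightarrow> nat) \<Rightarrow> (nat \<times> nat) set" where
  "inversions n w = {(a, b). 1 \<le> a \<and> a < b \<and> b \<le> n \<and> w b < w a}"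

lemma finite_inversions: "finite (inversions n w)"
  by (rule finite_subset[of _ "{1..n} \<times> {1..n}"]) (auto simp: inversions_def)

lemma simple_reflection_involutory [simp]: "simple_reflection i (simple_reflection i x) = x"
  by (simp add: simple_reflection_def)

lemma comp_simple_reflection_twice [simp]:
  "w \<circ> simple_reflection i \<circ> simple_reflection i = w"
  by (simp add: fun_eq_iff)

lemma simple_reflection_permutes:
  assumes "i \<in> {1..n - 1}"
  shows "simple_reflection i permutes {1..n}"
  using assms unfolding simple_reflection_def by (intro permutes_swap_id) auto

lemma simple_reflection_image_atLeastAtMost:
  assumes "1 \<le> i" "i \<noteq> k"
  shows "simple_reflection i ` {1..k} = {1..k}"
proof (cases "i < k")
  case True
  \<comment> \<open>\<open>simple_reflection_permutes\<close> is applied with \<open>k\<close> in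
    the role of \<open>n\<close>.\<close>
  then show ?thesis
    using assms by (intro permutes_image simple_reflection_permutes) auto
next
  case False
  then have "simple_reflection i j = j" if "j \<in> {1..k}" for j
    using assms that by (simp add: simple_reflection_def transpose_def)
  then show ?thesis by simp
qed

lemma simple_reflection_image_self:
  assumes "1 \<le> k"
  shows "simple_reflection k ` {1..k} = insert (Suc k) ({1..k} - {k})"
proof -
  have "simple_reflection k ` ({1..k} - {k}) = (\<lambda>j. j) ` ({1..k} - {k})"
    by (intro image_cong) (auto simp: simple_reflection_def)
  moreover have "{1..k} = insert k ({1..k} - {k})"
    using assms by auto
  then have "simple_reflection k ` {1..k}
    = insert (simple_reflection k k) (simple_reflection k ` ({1..k} - {k}))"
    by (metis image_insert)
  ultimately show ?thesis by (simp add: simple_reflection_def)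
qed

lemma word_product_Nil [simp]: "word_product [] = id"
  by (simp add: word_product_def)

lemma word_product_Cons [simp]:
  "word_product (i # is) = simple_reflection i \<circ> word_product is"
  by (simp add: word_product_def)

text \<open>\<open>word_product\<close> unfolds on the left, but the inductions below append on the
  right, where a letter acts on positions.\<close>

lemma word_product_snoc: "word_product (is @ [i]) = word_product is \<circ> simple_reflection i"
  by (induction "is") auto

section \<open>Inversion number under right multiplication\<close>

text \<open>Among pairs of positions \<open>a < b\<close>, \<open>\<sigma>\<^sub>i\<close> reverses
  the order of \<open>(i, Suc i)\<close> only.\<close>

lemma inversions_comp_simple_reflection:
  assumes i: "i \<in> {1..n - 1}"
  shows "map_prod (simple_reflection i) (simple_reflection i) ` (inversions n w - {(i, Suc i)})
    = inversions n (w \<circ> simple_reflection i) - {(i, Suc i)}" (is "?S ` ?A = ?B")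
proof -
  have sub: "map_prod (simple_reflection i) (simple_reflection i) ` (inversions n v - {(i, Suc i)})
    \<subseteq> inversions n (v \<circ> simple_reflection i) - {(i, Suc i)}" for v
  proof -
    have "(simple_reflection i a, simple_reflection i b)
        \<in> inversions n (v \<circ> simple_reflection i) - {(i, Suc i)}"
      if ab: "(a, b) \<in> inversions n v" and neq: "(a, b) \<noteq> (i, Suc i)" for a b
    proof -
      have less: "a < b" and ran: "a \<in> {1..n}" "b \<in> {1..n}" and inv: "v b < v a"
        using ab by (auto simp: inversions_def)
      have "simple_reflection i a < simple_reflection i b"
        using less neq by (auto simp: simple_reflection_def transpose_def)
      moreover have "simple_reflection i a \<in> {1..n}" "simple_reflection i b \<in> {1..n}"
        using ran permutes_in_image[OF simple_reflection_permutes[OF i]] by blast+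
      \<comment> \<open>Otherwise \<open>(a, b)\<close> would be \<open>(Suc i, i)\<close>, against
        \<open>a < b\<close>.\<close>
      moreover have "(simple_reflection i a, simple_reflection i b) \<noteq> (i, Suc i)"
        using less by (auto simp: simple_reflection_def transpose_def split: if_splits)
      ultimately show ?thesis using inv by (simp add: inversions_def)
    qed
    then show ?thesis by auto
  qed
  \<comment> \<open>\<open>?S\<close> is an involution, so the reverse inclusion is
    \<open>sub\<close> for \<open>w \<circ> simple_reflection i\<close>.\<close>
  have "?B = ?S ` ?S ` ?B"
    by (simp add: image_image map_prod_def case_prod_unfold)
  also have "\<dots> \<subseteq> ?S ` ?A"
    using sub[of "w \<circ> simple_reflection i"] by (intro image_mono) simp
  finally show ?thesis using sub[of w] by blast
qed

lemma card_inversions_comp_Diff: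
  assumes "i \<in> {1..n - 1}"
  shows "card (inversions n (w \<circ> simple_reflection i) - {(i, Suc i)})
    = card (inversions n w - {(i, Suc i)})"
proof -
  have "inj (map_prod (simple_reflection i) (simple_reflection i))"
    by (intro prod.inj_map) (metis injI simple_reflection_involutory)+
  then show ?thesis
    unfolding inversions_comp_simple_reflection[OF assms, symmetric]
    by (intro card_image) (auto intro: inj_on_subset)
qed

lemma card_inversions_comp_le:
  assumes "i \<in> {1..n - 1}"
  shows "card (inversions n (w \<circ> simple_reflection i)) \<le> Suc (card (inversions n w))"
proof -
  have "card (inversions n (w \<circ> simple_reflection i))
    \<le> Suc (card (inversions n (w \<circ> simple_reflection i) - {(i, Suc i)}))"
    by (simp add: card_Diff_singleton_if le_Suc_eq) linarith
  also have "\<dots> \<le> Suc (card (inversions n w))"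
    unfolding card_inversions_comp_Diff[OF assms]
    using finite_inversions by (simp add: card_Diff1_le)
  finally show ?thesis .
qed

text \<open>At a descent \<open>(i, Suc i)\<close> is an inversion of \<open>w\<close> but not of
  the product; the other inversions correspond.\<close>

lemma card_inversions_comp_descent:
  assumes "i \<in> {1..n - 1}" "w (Suc i) < w i"
  shows "card (inversions n w) = Suc (card (inversions n (w \<circ> simple_reflection i)))"
proof -
  have "(i, Suc i) \<in> inversions n w"
    using assms by (auto simp: inversions_def)
  then have "card (inversions n w) = Suc (card (inversions n w - {(i, Suc i)}))"
    by (metis card_Suc_Diff1 finite_inversions)
  moreover have "(i, Suc i) \<notin> inversions n (w \<circ> simple_reflection i)"
    using assms by (auto simp: inversions_def simple_reflection_def)
  ultimately show ?thesis
    using card_inversions_comp_Diff[OF assms(1), of w] by simp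
qed

lemma card_inversions_le_length:
  "set is \<subseteq> {1..n - 1} \<Longrightarrow> card (inversions n (word_product is)) \<le> length is"
proof (induction "is" rule: rev_induct)
  case Nil
  have "inversions n id = {}" by (auto simp: inversions_def)
  then show ?case unfolding word_product_Nil by (simp only: card.empty le0)
next
  case (snoc i "is")
  then show ?case
    using card_inversions_comp_le[of i n "word_product is"] unfolding word_product_snoc
    by (auto simp: o_def)
qed

section \<open>Lower bound on the occurrences of a letter\<close>

text \<open>This holds for all words, reduced or not: only the letter \<open>k\<close> moves the set
  \<open>{1..k}\<close>, and it exchanges a single element.\<close>

lemma card_crossings_le_count_list:
  assumes "1 \<le> k"
  shows "set is \<subseteq> {1..n - 1} \<Longrightarrow>
    card (word_product is ` {1..k} \<inter> {k + 1..n}) \<le> count_list is k"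
proof (induction "is" rule: rev_induct)
  case Nil
  have "{1..k} \<inter> {k + 1..n} = {}" by auto
  then show ?case by simp
next
  case (snoc i "is")
  define v where "v = word_product is"
  have IH: "card (v ` {1..k} \<inter> {k + 1..n}) \<le> count_list is k"
    using snoc by (simp add: v_def)
  have prod: "word_product (is @ [i]) ` {1..k} = v ` simple_reflection i ` {1..k}"
    by (simp add: v_def word_product_snoc image_comp)
  show ?case
  proof (cases "i = k")
    case True
    have "simple_reflection i ` {1..k} = insert (Suc k) ({1..k} - {k})"
      unfolding True by (rule simple_reflection_image_self[OF assms])
    \<comment> \<open>The only value that can be gained is \<open>v (Suc k)\<close>.\<close>
    then have "card (v ` simple_reflection i ` {1..k} \<inter> {k + 1..n})
      \<le> card (insert (v (Suc k)) (v ` {1..k} \<inter> {k + 1..n}))"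
      by (intro card_mono) auto
    also have "\<dots> \<le> Suc (card (v ` {1..k} \<inter> {k + 1..n}))"
      by (rule card_insert_le_m1) auto
    finally show ?thesis using IH True prod by simp
  next
    case False
    then have "simple_reflection i ` {1..k} = {1..k}"
      using snoc.prems by (intro simple_reflection_image_atLeastAtMost) auto
    then show ?thesis using IH False prod by simp
  qed
qed

section \<open>Permutations with at most one descent\<close>

lemma less_if_adjacent_less:
  fixes w :: "nat \<Rightarrow> nat"
  assumes "\<And>i. a \<le> i \<Longrightarrow> i < b \<Longrightarrow> w i < w (Suc i)" "a \<le> i" "i < j" "j \<le> b"
  shows "w i < w j"
proof -
  have "Suc i \<le> j" using assms by simp
  then have "j \<le> b \<longrightarrow> w i < w j"
  proof (induction j rule: dec_induct)
    case base
    then show ?case using assms(1)[of i] assms(2) by auto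
  next
    case (step m)
    then show ?case using assms(1)[of m] assms(2) by auto
  qed
  then show ?thesis using assms by simp
qed

text \<open>By strong induction all points below \<open>i\<close> are fixed, so the preimage
  \<open>j\<close> of \<open>i\<close> is not below \<open>i\<close>; if it were above, then
  \<open>w i < i\<close> would be fixed as well, against injectivity.\<close>

lemma permutes_no_descents_imp_id:
  assumes w: "w permutes {1..n::nat}" and asc: "\<And>i. 1 \<le> i \<Longrightarrow> i < n \<Longrightarrow> w i < w (Suc i)"
  shows "w = id"
proof -
  have "w i = i" for i
  proof (induction i rule: less_induct)
    case (less i)
    show ?case
    proof (cases "i \<in> {1..n}")
      case True
      obtain j where j: "j \<in> {1..n}" "w j = i"
        using True permutes_image[OF w] by (metis imageE)
      have "\<not> i < j"
      proof
        assume "i < j"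
        then have "w i < i"
          using less_if_adjacent_less[of 1 n w i j] asc True j by auto
        then show False using less[of "w i"] permutes_inj[OF w] by (metis injD less_irrefl)
      qed
      then show ?thesis using less j by (metis linorder_neqE_nat)
    qed (use w in \<open>simp add: permutes_not_in\<close>)
  qed
  then show ?thesis by auto
qed

text \<open>If \<open>w k \<le> k\<close>, then monotonicity makes \<open>w\<close> map
  \<open>{1..k}\<close> into itself, hence onto itself by counting. This forces
  \<open>w (Suc k) > k\<close>, against the descent. The second claim is the same argument on
  \<open>{Suc k..n}\<close>.\<close>

lemma only_descent_crosses:
  assumes w: "w permutes {1..n}" and k: "k \<in> {1..n - 1}" and desc: "w (Suc k) < w k"
    and asc: "\<And>i. i \<in> {1..n - 1} \<Longrightarrow> i \<noteq> k \<Longrightarrow> w i < w (Suc i)"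
  shows "k < w k" "w (Suc k) \<le> k"
proof -
  note inj = permutes_inj[OF w]
  have card_eq: "card (w ` A) = card A" for A
    by (rule card_image) (use inj inj_on_subset in blast)
  have range: "w i \<in> {1..n}" if "i \<in> {1..n}" for i
    using that permutes_in_image[OF w] by blast
  show "k < w k"
  proof (rule ccontr)
    assume "\<not> k < w k"
    moreover have "w i \<le> w k" if "i \<in> {1..k}" for i
      using less_if_adjacent_less[of 1 k w i k] asc that k by (cases "i = k") force+
    ultimately have "w ` {1..k} \<subseteq> {1..k}" using range k by fastforce
    then have "w ` {1..k} = {1..k}" by (intro card_subset_eq) (auto simp: card_eq)
    moreover have "w (Suc k) \<notin> w ` {1..k}" by (simp add: inj_image_mem_iff[OF inj])
    moreover have "1 \<le> w (Suc k)" using range[of "Suc k"] k by auto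
    ultimately show False using \<open>\<not> k < w k\<close> desc by auto
  qed
  show "w (Suc k) \<le> k"
  proof (rule ccontr)
    assume "\<not> w (Suc k) \<le> k"
    moreover have "w (Suc k) \<le> w i" if "i \<in> {Suc k..n}" for i
      using less_if_adjacent_less[of "Suc k" n w "Suc k" i] asc that k by (cases "i = Suc k") force+
    ultimately have "w ` {Suc k..n} \<subseteq> {Suc k..n}" using range k by fastforce
    then have "w ` {Suc k..n} = {Suc k..n}" by (intro card_subset_eq) (auto simp: card_eq)
    moreover have "w k \<notin> w ` {Suc k..n}" by (simp add: inj_image_mem_iff[OF inj])
    moreover have "w k \<le> n" using range[of k] k by auto
    ultimately show False using \<open>\<not> w (Suc k) \<le> k\<close> desc by auto
  qed
qed

section \<open>Construction of an optimal word\<close>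

text \<open>Both equalities must hold for the same word: the length makes it reduced, and the count
  attains the lower bound.\<close>

lemma exists_word_minimizing_both:
  assumes "w permutes {1..n}" "k \<in> {1..n - 1}"
  shows "\<exists>is. set is \<subseteq> {1..n - 1} \<and> word_product is = w \<and> length is = card (inversions n w)
    \<and> count_list is k = card (w ` {1..k} \<inter> {k + 1..n})"
  using assms(1)
proof (induction "card (inversions n w)" arbitrary: w rule: less_induct)
  case less
  note w = less.prems
  \<comment> \<open>Shared by both descent cases: a word for
    \<open>w \<circ> simple_reflection i\<close> is extended by \<open>i\<close>, and
    \<open>cross\<close> accounts for the added letter.\<close>
  have step: ?case
    if i: "i \<in> {1..n - 1}" and desc: "w (Suc i) < w i"
      and cross: "card (w ` {1..k} \<inter> {k + 1..n}) =
        card ((w \<circ> simple_reflection i) ` {1..k} \<inter> {k + 1..n}) + (if i = k then 1 else 0)" for i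
  proof -
    have inv: "card (inversions n w) = Suc (card (inversions n (w \<circ> simple_reflection i)))"
      using card_inversions_comp_descent[OF i desc] .
    have "w \<circ> simple_reflection i permutes {1..n}"
      using simple_reflection_permutes[OF i] w by (rule permutes_compose)
    with less.hyps[of "w \<circ> simple_reflection i"] inv obtain "is" where
      "set is \<subseteq> {1..n - 1}" "word_product is = w \<circ> simple_reflection i"
      "length is = card (inversions n (w \<circ> simple_reflection i))"
      "count_list is k = card ((w \<circ> simple_reflection i) ` {1..k} \<inter> {k + 1..n})" by auto
    with inv cross i show ?thesis
      by (intro exI[of _ "is @ [i]"]) (simp add: word_product_snoc)
  qed
  have neq: "w i \<noteq> w (Suc i)" for i
    using permutes_inj[OF w] by (metis injD n_not_Suc_n)
  \<comment> \<open>The descent \<open>k\<close> is used only as a last resort: for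
    \<open>w = 321\<close> and \<open>k = 1\<close>, stripping it off leaves the cardinality
    unchanged.\<close>
  consider (id) "w = id" | (other) i where "i \<in> {1..n - 1}" "i \<noteq> k" "w (Suc i) < w i"
    | (only) "w (Suc k) < w k" "\<And>i. i \<in> {1..n - 1} \<Longrightarrow> i \<noteq> k \<Longrightarrow> w i < w (Suc i)"
  proof (cases "\<exists>i \<in> {1..n - 1}. i \<noteq> k \<and> w (Suc i) < w i")
    case True
    then show ?thesis using other by blast
  next
    case False
    then have asc: "w i < w (Suc i)" if "i \<in> {1..n - 1}" "i \<noteq> k" for i
      using that neq[of i] by (meson linorder_neqE_nat)
    show ?thesis
    proof (cases "w (Suc k) < w k")
      case True
      then show ?thesis using only asc by blast
    next
      case False
      then have "w i < w (Suc i)" if "1 \<le> i" "i < n" for i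
        using that asc[of i] neq[of i] by (cases "i = k") auto
      then show ?thesis using id permutes_no_descents_imp_id[OF w] by blast
    qed
  qed
  then show ?case
  proof cases
    case id
    have "inversions n id = {}" "{1..k} \<inter> {k + 1..n} = {}" by (auto simp: inversions_def)
    then show ?thesis using id by (intro exI[of _ "[]"]) simp
  next
    case (other i)
    then have "simple_reflection i ` {1..k} = {1..k}"
      by (intro simple_reflection_image_atLeastAtMost) auto
    then show ?thesis using other by (intro step[of i])
      (simp_all only: image_comp[symmetric] if_False add_0_right)
  next
    case only
    note cross = only_descent_crosses[OF w assms(2) only]
    have "(w \<circ> simple_reflection k) ` {1..k} = insert (w (Suc k)) (w ` {1..k} - {w k})"
      using assms(2) permutes_inj[OF w] unfolding image_comp[symmetric]
      by (subst simple_reflection_image_self) (auto simp: image_set_diff)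
    \<comment> \<open>The incoming value \<open>w (Suc k)\<close> is at most \<open>k\<close>, so it
      is not counted, while the outgoing \<open>w k\<close> was.\<close>
    then have "(w \<circ> simple_reflection k) ` {1..k} \<inter> {k + 1..n}
      = (w ` {1..k} \<inter> {k + 1..n}) - {w k}"
      using cross by auto
    moreover have "w k \<in> {1..n}"
      using assms(2) permutes_in_image[OF w, of k] by auto
    then have "w k \<in> w ` {1..k} \<inter> {k + 1..n}"
      using cross assms(2) by auto
    ultimately have "card (w ` {1..k} \<inter> {k + 1..n}) =
        card ((w \<circ> simple_reflection k) ` {1..k} \<inter> {k + 1..n}) + 1"
      using card_Suc_Diff1[of "w ` {1..k} \<inter> {k + 1..n}" "w k"] by simp
    then show ?thesis using only assms(2) by (intro step[of k]) auto
  qed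
qed

section \<open>Length, symmetry and conclusion\<close>

lemma perm_length_eq_card_inversions:
  assumes "w permutes {1..n}" "n \<ge> 2"
  shows "perm_length n w = card (inversions n w)"
  unfolding perm_length_def
proof (rule Least_equality)
  show "\<exists>is\<in>decompositions n w. length is = card (inversions n w)"
  proof -
    \<comment> \<open>Any letter would serve here; \<open>n \<ge> 2\<close> ensures that there is
      one.\<close>
    have "1 \<in> {1..n - 1}" using assms(2) by auto
    from exists_word_minimizing_both[OF assms(1) this] show ?thesis
      unfolding decompositions_def by blast
  qed
next
  show "card (inversions n w) \<le> r" if "\<exists>is\<in>decompositions n w. length is = r" for r
    using that card_inversions_le_length[of _ n] unfolding decompositions_def by blast
qed

lemma card_crossings_symmetric:
  fixes n k :: nat
  assumes "w permutes {1..n}" "k \<le> n"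
  shows "card (w ` {1..k} \<inter> {k + 1..n}) = card (w ` {k + 1..n} \<inter> {1..k})"
proof -
  note inj = permutes_inj[OF assms(1)]
  have img: "w ` {1..n} = {1..n}" using permutes_image[OF assms(1)] .
  have "w ` {1..k} \<subseteq> w ` {1..n}" using assms(2) by (intro image_mono) auto
  then have "w ` {1..k} \<inter> {k + 1..n} = w ` {1..k} - w ` {1..k} \<inter> {1..k}"
    unfolding img by fastforce
  moreover have "card (w ` {1..k}) = k"
    using card_image[of w "{1..k}"] inj inj_on_subset by fastforce
  moreover have "{k + 1..n} = {1..n} - {1..k}" by auto
  then have "w ` {k + 1..n} = {1..n} - w ` {1..k}"
    by (simp only: img image_set_diff[OF inj])
  then have "w ` {k + 1..n} \<inter> {1..k} = {1..k} - w ` {1..k} \<inter> {1..k}"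
    using assms(2) by auto
  ultimately show ?thesis by (simp add: card_Diff_subset)
qed

theorem theorem2p2:
  fixes n k :: nat and w :: "nat \<Rightarrow> nat"
  assumes "n \<ge> 2"
    and "w permutes {1..n}"
    and "k \<in> {1..n - 1}"
  shows "min_occ n k w = card (w ` {1..k} \<inter> {k + 1..n})
    \<and> card (w ` {1..k} \<inter> {k + 1..n}) = card (w ` {k + 1..n} \<inter> {1..k})"
proof
  \<comment> \<open>The first factor, words of fixed length over a finite alphabet, gives the
    finiteness that \<open>Min\<close> requires.\<close>
  have red: "reduced_decompositions n w =
    {is. set is \<subseteq> {1..n - 1} \<and> length is = card (inversions n w)} \<inter> {is. word_product is = w}"
    using assms
    by (auto simp: reduced_decompositions_def decompositions_def perm_length_eq_card_inversions)
  show "min_occ n k w = card (w ` {1..k} \<inter> {k + 1..n})"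
    unfolding min_occ_def
  proof (rule Min_eqI)
    show "finite ((\<lambda>is. count_list is k) ` reduced_decompositions n w)"
      unfolding red by (intro finite_imageI finite_Int disjI1 finite_lists_length_eq) simp
    show "card (w ` {1..k} \<inter> {k + 1..n}) \<le> m"
      if "m \<in> (\<lambda>is. count_list is k) ` reduced_decompositions n w" for m
      using that assms(3) card_crossings_le_count_list[of k _ n] by (force simp: red)
    show "card (w ` {1..k} \<inter> {k + 1..n}) \<in> (\<lambda>is. count_list is k) ` reduced_decompositions n w"
    proof -
      obtain "is" where "is \<in> reduced_decompositions n w"
        "count_list is k = card (w ` {1..k} \<inter> {k + 1..n})"
        using exists_word_minimizing_both[OF assms(2,3)] unfolding red by blast
      then show ?thesis by (intro image_eqI) simp_all
    qed
  qed
  show "card (w ` {1..k} \<inter> {k + 1..n}) = card (w ` {k + 1..n} \<inter> {1..k})"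
    using assms by (intro card_crossings_symmetric) auto
qed

end
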